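(* Let $p>\frac12$ and consider Bernoulli bond percolation on $\mathbb{Z}^2$ with parameter $p$. For almost every percolation configuration the following holds: if $X$ and $Y$ are two independent discrete-time simple random walks on the infinite percolation cluster $C_\infty$, started from the same point of $C_\infty$, then almost surely $X_t=Y_t$ for infinitely many $t$.
   Context: In Bernoulli bond percolation with parameter $p$, each nearest-neighbour edge of $\mathbb{Z}^2$ is open with probability $p$ independently of the others. For $p>\frac12$ (the supercritical regime) there is a.s. a unique infinite connected component of open edges, denoted $C_\infty$. Simple random walk on $C_\infty$ jumps at each integer time to a uniformly chosen neighbour along an open edge. *)

theory Defs
  imports "HOL-Probability.Probability"
begin

type_synonym vertex = "int \<times> int"

definition lattice_edges :: "vertex set set" where
  "lattice_edges =
    {{x, y} | x y. \<bar>fst x - fst y\<bar> + \<bar>snd x - snd y\<bar> = 1}"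

text \<open>A configuration assigns to each edge whether it is open.  As a point of the product
  space over \<^const>\<open>lattice_edges\<close>, it has no meaningful value on other vertex sets.\<close>

type_synonym configuration = "vertex set \<Rightarrow> bool"

definition bond_percolation :: "real \<Rightarrow> configuration measure" where
  "bond_percolation p = Pi\<^sub>M lattice_edges (\<lambda>_. measure_pmf (bernoulli_pmf p))"

definition open_adj :: "configuration \<Rightarrow> vertex \<Rightarrow> vertex \<Rightarrow> bool" where
  "open_adj \<omega> x y \<longleftrightarrow> {x, y} \<in> lattice_edges \<and> \<omega> {x, y}"

definition open_neighbours :: "configuration \<Rightarrow> vertex \<Rightarrow> vertex set" where
  "open_neighbours \<omega> x = {y. open_adj \<omega> x y}"

definition open_cluster :: "configuration \<Rightarrow> vertex \<Rightarrow> vertex set" where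
  "open_cluster \<omega> x = {y. (open_adj \<omega>)\<^sup>*\<^sup>* x y}"

text \<open>For \<open>p > 1/2\<close> almost every configuration has exactly one infinite cluster,
  so this predicate almost surely singles out the cluster \<open>C\<^sub>\<infinity>\<close>.\<close>

definition infinite_cluster :: "configuration \<Rightarrow> vertex set \<Rightarrow> bool" where
  "infinite_cluster \<omega> C \<longleftrightarrow> C \<in> range (open_cluster \<omega>) \<and> infinite C"

text \<open>The conditional probability is constrained only on histories of positive probability.
  For a starting point in an infinite cluster these histories stay in that cluster, so
  \<^const>\<open>pmf_of_set\<close> is only used on nonempty finite sets of neighbours.\<close>

definition simple_random_walk ::
  "'m measure \<Rightarrow> configuration \<Rightarrow> vertex \<Rightarrow> (nat \<Rightarrow> 'm \<Rightarrow> vertex) \<Rightarrow> bool" where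
  "simple_random_walk M \<omega> x\<^sub>0 X \<longleftrightarrow>
    (\<forall>t. X t \<in> measurable M (count_space UNIV)) \<and>
    (AE w in M. X 0 w = x\<^sub>0) \<and>
    (\<forall>t h y. \<P>(w in M. \<forall>s\<le>t. X s w = h s) > 0 \<longrightarrow>
       \<P>(w in M. X (Suc t) w = y \<bar> \<forall>s\<le>t. X s w = h s)
         = pmf (pmf_of_set (open_neighbours \<omega> (h t))) y)"

definition independent_processes ::
  "'m measure \<Rightarrow> (nat \<Rightarrow> 'm \<Rightarrow> vertex) \<Rightarrow> (nat \<Rightarrow> 'm \<Rightarrow> vertex) \<Rightarrow> bool" where
  "independent_processes M X Y \<longleftrightarrow>
    prob_space.indep_var M
      (Pi\<^sub>M UNIV (\<lambda>_. count_space UNIV)) (\<lambda>w t. X t w)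
      (Pi\<^sub>M UNIV (\<lambda>_. count_space UNIV)) (\<lambda>w t. Y t w)"

end

theory Submission
  imports Defs
begin

text \<open>
  The argument follows Hutchcroft and Peres. Let \<open>q v\<close> be the probability that two independent walks
  started at \<open>v\<close> never meet again, and let \<open>K\<^sup>n\<close> be the \<open>n\<close>-step transition kernel. Decomposing
  according to the last collision gives \<open>\<Sum>n u. K\<^sup>n(0, u)\<^sup>2 q u \<le> 1\<close>. Percolation is translation invariant,
  so transporting mass yields \<open>E [q 0 * (\<Sum>n u. K\<^sup>n(u, 0)\<^sup>2)] \<le> 1\<close>. By reversibility the inner sum is
  comparable to the Green function of the walk at the origin, which is infinite because every
  subgraph of the square lattice is recurrent; hence \<open>q 0 = 0\<close> almost surely whenever the origin
  is not isolated. So almost surely no collision is the last one.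
\<close>

section \<open>Neighbours in the square lattice and along open edges\<close>

definition lattice_neighbours :: "vertex \<Rightarrow> vertex set" where
  "lattice_neighbours x = {y. \<bar>fst x - fst y\<bar> + \<bar>snd x - snd y\<bar> = 1}"

lemma lattice_neighbours_eq:
  "lattice_neighbours x = {x + (1, 0), x - (1, 0), x + (0, 1), x - (0, 1)}"
proof -
  have "y \<in> lattice_neighbours x \<longleftrightarrow> y \<in> {x + (1, 0), x - (1, 0), x + (0, 1), x - (0, 1)}" for y
    by (cases x; cases y; simp add: lattice_neighbours_def; presburger)
  then show ?thesis by blast
qed

lemma finite_lattice_neighbours: "finite (lattice_neighbours x)"
  by (simp add: lattice_neighbours_eq)

lemma card_lattice_neighbours_le: "card (lattice_neighbours x) \<le> 4"
  unfolding lattice_neighbours_eq by (simp add: card_insert_if)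

lemma lattice_edge_iff: "{x, y} \<in> lattice_edges \<longleftrightarrow> y \<in> lattice_neighbours x"
proof
  assume "{x, y} \<in> lattice_edges"
  then obtain a b where ab: "{x, y} = {a, b}" "\<bar>fst a - fst b\<bar> + \<bar>snd a - snd b\<bar> = 1"
    by (auto simp: lattice_edges_def)
  then show "y \<in> lattice_neighbours x"
    by (auto simp: lattice_neighbours_def doubleton_eq_iff abs_minus_commute)
qed (unfold lattice_neighbours_def lattice_edges_def, blast)

lemma lattice_neighbours_sym: "y \<in> lattice_neighbours x \<longleftrightarrow> x \<in> lattice_neighbours y"
  by (auto simp: lattice_neighbours_def abs_minus_commute)

lemma open_adj_sym: "open_adj \<omega> x y \<longleftrightarrow> open_adj \<omega> y x"
  by (simp add: open_adj_def insert_commute)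

lemma open_neighbours_subset: "open_neighbours \<omega> x \<subseteq> lattice_neighbours x"
  by (auto simp: open_neighbours_def open_adj_def lattice_edge_iff)

lemma finite_open_neighbours [simp]: "finite (open_neighbours \<omega> x)"
  by (rule finite_subset[OF open_neighbours_subset finite_lattice_neighbours])

definition deg :: "configuration \<Rightarrow> vertex \<Rightarrow> real" where
  "deg \<omega> x = real (card (open_neighbours \<omega> x))"

lemma deg_nonneg [simp]: "0 \<le> deg \<omega> x"
  by (simp add: deg_def)

lemma deg_le_4: "deg \<omega> x \<le> 4"
proof -
  have "card (open_neighbours \<omega> x) \<le> 4"
    using card_mono[OF finite_lattice_neighbours open_neighbours_subset]
      card_lattice_neighbours_le order_trans by blast
  then show ?thesis by (simp add: deg_def)
qed

text \<open>A sum over a random set becomes a sum of indicators over a fixed finite set; in this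
  form measurability in the configuration can be proved.\<close>

lemma sum_open_neighbours:
  "(\<Sum>y\<in>open_neighbours \<omega> x. f y) = (\<Sum>y\<in>lattice_neighbours x. if open_adj \<omega> x y then f y else 0)"
  for f :: "vertex \<Rightarrow> real"
proof -
  have "open_neighbours \<omega> x = {y\<in>lattice_neighbours x. open_adj \<omega> x y}"
    using open_neighbours_subset[of \<omega> x] by (auto simp: open_neighbours_def)
  then show ?thesis
    by (simp add: sum.inter_filter finite_lattice_neighbours)
qed

lemma deg_eq_sum: "deg \<omega> x = (\<Sum>y\<in>lattice_neighbours x. if open_adj \<omega> x y then 1 else 0)"
  using sum_open_neighbours[of "\<lambda>_. 1"] by (simp add: deg_def)

subsection \<open>Heat kernel and avoidance probabilities\<close>

text \<open>The kernel \<open>K\<^sup>n\<close>, expanded at the first step. At an isolated vertex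
  division by zero makes it vanish for \<open>n > 0\<close>, as if the walk were killed
  there.\<close>

primrec heat :: "configuration \<Rightarrow> nat \<Rightarrow> vertex \<Rightarrow> vertex \<Rightarrow> real" where
  "heat \<omega> 0 x y = of_bool (x = y)"
| "heat \<omega> (Suc n) x y = (\<Sum>z\<in>open_neighbours \<omega> x. heat \<omega> n z y) / deg \<omega> x"

text \<open>Probability that independent walks from \<open>x\<close> and \<open>y\<close> do not
  meet at times \<open>1\<close> to \<open>n\<close>. Time 0 is left out, so that equal starting
  points are meaningful.\<close>

primrec avoid :: "configuration \<Rightarrow> nat \<Rightarrow> vertex \<Rightarrow> vertex \<Rightarrow> real" where
  "avoid \<omega> 0 x y = 1"
| "avoid \<omega> (Suc n) x y =
    (\<Sum>x'\<in>open_neighbours \<omega> x. \<Sum>y'\<in>open_neighbours \<omega> y. of_bool (x' \<noteq> y') * avoid \<omega> n x' y')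
      / (deg \<omega> x * deg \<omega> y)"

text \<open>This is \<open>q v\<close>: the values \<open>avoid \<omega> n v v\<close> decrease in
  \<open>n\<close>, so the infimum is their limit.\<close>

definition escape :: "configuration \<Rightarrow> vertex \<Rightarrow> real" where
  "escape \<omega> v = (INF n. avoid \<omega> n v v)"

lemma heat_nonneg [simp]: "0 \<le> heat \<omega> n x y"
  by (induction n arbitrary: x) (auto intro!: sum_nonneg divide_nonneg_nonneg)

lemma avoid_nonneg [simp]: "0 \<le> avoid \<omega> n x y"
  by (induction n arbitrary: x y) (auto intro!: sum_nonneg divide_nonneg_nonneg)

lemma bdd_below_avoid: "bdd_below (range (\<lambda>n. avoid \<omega> n v v))"
  by (rule bdd_belowI[of _ 0]) auto

lemma escape_le_avoid: "escape \<omega> v \<le> avoid \<omega> n v v"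
  unfolding escape_def by (rule cINF_lower[OF bdd_below_avoid]) simp

lemma escape_nonneg [simp]: "0 \<le> escape \<omega> v"
  unfolding escape_def by (rule cINF_greatest) auto

text \<open>The summands are the probabilities that the last collision of the two walks up to time
  \<open>N\<close> happens at time \<open>n\<close> and at the vertex \<open>u\<close>.\<close>

lemma last_collision_bound:
  assumes "finite A"
  shows "of_bool (x \<noteq> y) * avoid \<omega> N x y
    + (\<Sum>n\<le>N. \<Sum>u\<in>A. heat \<omega> n x u * heat \<omega> n y u * avoid \<omega> (N - n) u u) \<le> 1"
proof (induction N arbitrary: x y)
  case 0
  have "(\<Sum>u\<in>A. of_bool (x = u) * of_bool (y = u) :: real) \<le> of_bool (x = y)"
  proof -
    have "(\<Sum>u\<in>A. of_bool (x = u) * of_bool (y = u)) = (\<Sum>u\<in>A. if x = u then of_bool (y = u) else 0 :: real)"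
      by (intro sum.cong) auto
    also have "\<dots> \<le> of_bool (x = y)" using assms by auto
    finally show ?thesis .
  qed
  then show ?case by (cases "x = y") auto
next
  case (Suc N)
  define c where "c = deg \<omega> x * deg \<omega> y"
  define S where "S x' y' = (\<Sum>n\<le>N. \<Sum>u\<in>A. heat \<omega> n x' u * heat \<omega> n y' u * avoid \<omega> (N - n) u u)"
    for x' y'
  have c: "0 \<le> c" by (simp add: c_def)
  have "(\<Sum>u\<in>A. of_bool (x = u) * of_bool (y = u) * avoid \<omega> (Suc N) u u)
      = (\<Sum>u\<in>A. if x = u then of_bool (y = u) * avoid \<omega> (Suc N) u u else 0)"
    by (intro sum.cong) auto
  also have "\<dots> \<le> of_bool (x = y) * avoid \<omega> (Suc N) x y"
    using assms by (auto simp del: avoid.simps)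
  \<comment> \<open>A collision at time 0 forces \<open>x = y\<close>, so this term complements the
    one for no collision at all.\<close>
  finally have first: "(\<Sum>u\<in>A. heat \<omega> 0 x u * heat \<omega> 0 y u * avoid \<omega> (Suc N) u u)
      \<le> of_bool (x = y) * avoid \<omega> (Suc N) x y" by simp
  have step: "heat \<omega> (Suc n) x u * heat \<omega> (Suc n) y u * a
      = (\<Sum>x'\<in>open_neighbours \<omega> x. \<Sum>y'\<in>open_neighbours \<omega> y. heat \<omega> n x' u * heat \<omega> n y' u * a) / c"
    for n u a
  proof -
    have "heat \<omega> (Suc n) x u * heat \<omega> (Suc n) y u * a
        = (\<Sum>x'\<in>open_neighbours \<omega> x. heat \<omega> n x' u) * (\<Sum>y'\<in>open_neighbours \<omega> y. heat \<omega> n y' u) * a / c"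
      by (simp add: c_def)
    then show ?thesis unfolding sum_product by (simp only: sum_distrib_right)
  qed
  have "(\<Sum>n\<le>N. \<Sum>u\<in>A. heat \<omega> (Suc n) x u * heat \<omega> (Suc n) y u * avoid \<omega> (N - n) u u)
      = (\<Sum>n\<le>N. \<Sum>u\<in>A. \<Sum>x'\<in>open_neighbours \<omega> x. \<Sum>y'\<in>open_neighbours \<omega> y.
          heat \<omega> n x' u * heat \<omega> n y' u * avoid \<omega> (N - n) u u) / c"
    unfolding step by (simp add: sum_divide_distrib)
  also have "\<dots> = (\<Sum>x'\<in>open_neighbours \<omega> x. \<Sum>y'\<in>open_neighbours \<omega> y. S x' y') / c"
    unfolding S_def
    by (subst sum.swap[of _ "open_neighbours \<omega> x" A], subst sum.swap[of _ "open_neighbours \<omega> x" "{..N}"])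
       (simp only: sum.swap[of _ "open_neighbours \<omega> y"])
  finally have later: "(\<Sum>n\<le>N. \<Sum>u\<in>A. heat \<omega> (Suc n) x u * heat \<omega> (Suc n) y u * avoid \<omega> (N - n) u u)
      = (\<Sum>x'\<in>open_neighbours \<omega> x. \<Sum>y'\<in>open_neighbours \<omega> y. S x' y') / c" .
  have "of_bool (x \<noteq> y) * avoid \<omega> (Suc N) x y
      + (\<Sum>n\<le>Suc N. \<Sum>u\<in>A. heat \<omega> n x u * heat \<omega> n y u * avoid \<omega> (Suc N - n) u u)
      = of_bool (x \<noteq> y) * avoid \<omega> (Suc N) x y
      + (\<Sum>u\<in>A. heat \<omega> 0 x u * heat \<omega> 0 y u * avoid \<omega> (Suc N) u u)
      + (\<Sum>n\<le>N. \<Sum>u\<in>A. heat \<omega> (Suc n) x u * heat \<omega> (Suc n) y u * avoid \<omega> (N - n) u u)"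
    unfolding sum.atMost_Suc_shift by (simp only: diff_Suc_Suc diff_zero add.assoc)
  also have "\<dots> \<le> avoid \<omega> (Suc N) x y + (\<Sum>x'\<in>open_neighbours \<omega> x. \<Sum>y'\<in>open_neighbours \<omega> y. S x' y') / c"
    unfolding later using first by (cases "x = y") (auto simp del: avoid.simps heat.simps)
  \<comment> \<open>Both terms are now averages over the first pair of steps, and the induction
    hypothesis bounds the averaged quantity.\<close>
  also have "\<dots> = (\<Sum>x'\<in>open_neighbours \<omega> x. \<Sum>y'\<in>open_neighbours \<omega> y.
      of_bool (x' \<noteq> y') * avoid \<omega> N x' y' + S x' y') / c"
    by (simp add: c_def sum.distrib add_divide_distrib)
  also have "\<dots> \<le> (\<Sum>x'\<in>open_neighbours \<omega> x. \<Sum>y'\<in>open_neighbours \<omega> y. 1) / c"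
    using Suc.IH by (intro divide_right_mono sum_mono c) (simp add: S_def)
  \<comment> \<open>There are \<open>c\<close> pairs of neighbours; if \<open>c = 0\<close>,
    division by zero gives 0.\<close>
  also have "\<dots> \<le> 1"
    by (simp add: c_def deg_def)
  finally show ?case .
qed

subsection \<open>Recurrence of subgraphs of the square lattice\<close>

definition sup_norm :: "vertex \<Rightarrow> nat" where
  "sup_norm x = nat (max \<bar>fst x\<bar> \<bar>snd x\<bar>)"

definition square :: "nat \<Rightarrow> vertex set" where
  "square n = {x. sup_norm x \<le> n}"

lemma square_eq: "square n = {- int n..int n} \<times> {- int n..int n}"
  by (auto simp: square_def sup_norm_def)

lemma finite_square [simp]: "finite (square n)"
  by (simp add: square_eq)

lemma card_square: "card (square n) = (2 * n + 1)\<^sup>2"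
  by (simp add: square_eq card_cartesian_product power2_eq_square nat_add_distrib nat_mult_distrib algebra_simps)

lemma square_mono: "m \<le> n \<Longrightarrow> square m \<subseteq> square n"
  by (auto simp: square_def)

lemma zero_in_square [simp]: "0 \<in> square n"
  by (simp add: square_def sup_norm_def)

lemma uminus_in_square_iff [simp]: "- x \<in> square n \<longleftrightarrow> x \<in> square n"
  by (simp add: square_def sup_norm_def)

lemma sup_norm_neighbour: "y \<in> lattice_neighbours x \<Longrightarrow> sup_norm y \<le> Suc (sup_norm x)"
  unfolding lattice_neighbours_def sup_norm_def mem_Collect_eq by linarith

lemma neighbour_in_square: "x \<in> square n \<Longrightarrow> y \<in> lattice_neighbours x \<Longrightarrow> y \<in> square (Suc n)"
  using sup_norm_neighbour[of y x] by (simp add: square_def)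

text \<open>For \<open>r > 0\<close> the sphere has
  \<open>(2 r + 1)\<^sup>2 - (2 r - 1)\<^sup>2 = 8 r\<close> points; the extra 8 covers
  \<open>r = 0\<close>.\<close>

lemma card_sphere_le: "card {x. sup_norm x = r} \<le> 8 * (r + 1)"
proof (cases r)
  case 0
  have "{x. sup_norm x = r} \<subseteq> {0}"
    using 0 by (auto simp: sup_norm_def zero_prod_def)
  then have "card {x. sup_norm x = r} \<le> card {0 :: vertex}"
    by (rule card_mono[rotated]) simp
  then show ?thesis by simp
next
  case (Suc k)
  have "{x. sup_norm x = r} = square r - square k"
    using Suc by (auto simp: square_def)
  then have "card {x. sup_norm x = r} = card (square r) - card (square k)"
    using Suc by (simp add: card_Diff_subset square_mono)
  then show ?thesis
    unfolding card_square Suc by (simp add: power2_eq_square algebra_simps)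
qed

text \<open>Summing shell by shell turns a planar sum into a one-dimensional one.\<close>

lemma sum_radial_le:
  fixes w :: "nat \<Rightarrow> real"
  assumes "\<And>r. 0 \<le> w r"
  shows "(\<Sum>x | sup_norm x < N. w (sup_norm x)) \<le> (\<Sum>r<N. 8 * (real r + 1) * w r)"
proof (induction N)
  case (Suc N)
  have fin: "finite {x. sup_norm x < N}" "finite {x. sup_norm x = N}"
    by (auto intro: finite_subset[OF _ finite_square[of N]] simp: square_def)
  have "{x. sup_norm x < Suc N} = {x. sup_norm x < N} \<union> {x. sup_norm x = N}"
    by auto
  then have "(\<Sum>x | sup_norm x < Suc N. w (sup_norm x))
      = (\<Sum>x | sup_norm x < N. w (sup_norm x)) + (\<Sum>x | sup_norm x = N. w (sup_norm x))"
    using fin by (simp add: sum.union_disjoint disjoint_iff)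
  also have "(\<Sum>x | sup_norm x = N. w (sup_norm x)) = real (card {x. sup_norm x = N}) * w N"
    by simp
  also have "\<dots> \<le> real (8 * (N + 1)) * w N"
    by (intro mult_right_mono assms of_nat_mono card_sphere_le)
  finally show ?case using Suc.IH by (simp add: algebra_simps)
qed simp

section \<open>The Dirichlet form and a test function of small energy\<close>

definition dirichlet ::
  "configuration \<Rightarrow> vertex set \<Rightarrow> (vertex \<Rightarrow> real) \<Rightarrow> (vertex \<Rightarrow> real) \<Rightarrow> real" where
  "dirichlet \<omega> B f g =
    (\<Sum>x\<in>B. \<Sum>y\<in>B. of_bool (open_adj \<omega> x y) * ((f x - f y) * (g x - g y))) / 2"

lemma sum_open_adj:
  fixes F :: "vertex \<Rightarrow> real"
  assumes "finite B" "open_neighbours \<omega> x \<subseteq> B"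
  shows "(\<Sum>y\<in>B. of_bool (open_adj \<omega> x y) * F y) = (\<Sum>y\<in>open_neighbours \<omega> x. F y)"
proof -
  have "(\<Sum>y\<in>open_neighbours \<omega> x. F y) = (\<Sum>y\<in>open_neighbours \<omega> x. of_bool (open_adj \<omega> x y) * F y)"
    by (intro sum.cong) (auto simp: open_neighbours_def)
  also have "\<dots> = (\<Sum>y\<in>B. of_bool (open_adj \<omega> x y) * F y)"
    by (rule sum.mono_neutral_left) (use assms in \<open>auto simp: open_neighbours_def\<close>)
  finally show ?thesis by simp
qed

lemma open_neighbours_subset_square: "x \<in> square m \<Longrightarrow> open_neighbours \<omega> x \<subseteq> square (Suc m)"
  using open_neighbours_subset neighbour_in_square by blast

text \<open>Discrete Green identity. All neighbours of the support of \<open>f\<close> lie in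
  \<open>B\<close>, so no boundary term appears; elsewhere the factor \<open>f x\<close> vanishes.
  The factor 1/2 in \<open>dirichlet\<close> offsets that each edge occurs in both
  directions.\<close>

lemma dirichlet_eq:
  assumes "\<And>x. x \<notin> square m \<Longrightarrow> f x = 0" "square (Suc m) \<subseteq> B" "finite B"
  shows "dirichlet \<omega> B f g
    = (\<Sum>x\<in>B. f x * (deg \<omega> x * g x - (\<Sum>y\<in>open_neighbours \<omega> x. g y)))"
proof -
  let ?a = "\<lambda>x y. of_bool (open_adj \<omega> x y) :: real"
  define T where "T = (\<Sum>x\<in>B. \<Sum>y\<in>B. ?a x y * (f x * (g x - g y)))"
  have "(\<Sum>x\<in>B. \<Sum>y\<in>B. ?a x y * ((f x - f y) * (g x - g y)))
      = T + (\<Sum>x\<in>B. \<Sum>y\<in>B. ?a x y * (f y * (g y - g x)))"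
    unfolding T_def sum.distrib[symmetric] by (intro sum.cong refl) (simp add: algebra_simps)
  also have "(\<Sum>x\<in>B. \<Sum>y\<in>B. ?a x y * (f y * (g y - g x))) = T"
    unfolding T_def by (subst sum.swap) (simp add: open_adj_sym)
  finally have "dirichlet \<omega> B f g = T" by (simp add: dirichlet_def)
  also have "T = (\<Sum>x\<in>B. f x * (deg \<omega> x * g x - (\<Sum>y\<in>open_neighbours \<omega> x. g y)))"
    unfolding T_def
  proof (intro sum.cong refl)
    fix x
    show "(\<Sum>y\<in>B. ?a x y * (f x * (g x - g y)))
        = f x * (deg \<omega> x * g x - (\<Sum>y\<in>open_neighbours \<omega> x. g y))"
    proof (cases "x \<in> square m")
      case True
      then have "open_neighbours \<omega> x \<subseteq> B"
        using open_neighbours_subset_square assms(2) by blast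
      then show ?thesis
        unfolding sum_open_adj[OF assms(3) \<open>open_neighbours \<omega> x \<subseteq> B\<close>]
        by (simp add: sum_distrib_left[symmetric] sum_subtractf deg_def)
    qed (simp add: assms(1))
  qed
  finally show ?thesis .
qed

text \<open>The form is an inner product of differences along ordered edges, since the indicator of
  an open edge equals its square.\<close>

lemma dirichlet_Cauchy_Schwarz:
  "(dirichlet \<omega> B f g)\<^sup>2 \<le> dirichlet \<omega> B f f * dirichlet \<omega> B g g"
proof -
  let ?a = "\<lambda>p. of_bool (open_adj \<omega> (fst p) (snd p)) :: real"
  let ?d = "\<lambda>f p. ?a p * (f (fst p) - f (snd p))"
  have a: "?a p * (s * t) = (?a p * s) * (?a p * t)" for p s t by simp
  have D: "dirichlet \<omega> B f g = (\<Sum>p\<in>B \<times> B. ?d f p * ?d g p) / 2" for f g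
    unfolding dirichlet_def a[symmetric] by (simp add: sum.cartesian_product case_prod_unfold)
  show ?thesis
    using Cauchy_Schwarz_ineq_sum[of "?d f" "?d g" "B \<times> B"]
    unfolding D by (simp add: power2_eq_square)
qed

text \<open>The test function decays like the harmonic series in the radius, which is the logarithmic
  potential of the plane; its energy is of order \<open>1 / harm N\<close>.\<close>

lemma ex_small_energy:
  assumes "0 < \<epsilon>"
  obtains m f where "f 0 = 1" "\<And>x. x \<notin> square m \<Longrightarrow> f x = 0"
    "\<And>\<omega> B. finite B \<Longrightarrow> dirichlet \<omega> B f f \<le> \<epsilon>"
proof -
  \<comment> \<open>The energy bound will be \<open>32 / harm N\<close>: 4 bounds the degree and 8
    comes from the size of the spheres.\<close>
  have "eventually (\<lambda>N. harm N > 32 / \<epsilon>) sequentially"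
    using harm_at_top by (simp add: filterlim_at_top_dense)
  then obtain N where N: "harm N > 32 / \<epsilon>" by (auto simp: eventually_sequentially)
  define H where "H = (harm N :: real)"
  have "0 < 32 / \<epsilon>" using assms by simp
  then have H: "0 < H" using N unfolding H_def by (rule less_trans)
  then have H': "32 / H < \<epsilon>"
    using N assms by (simp add: H_def field_simps)
  define \<phi> where "\<phi> r = max 0 (1 - harm r / H)" for r
  define f where "f x = \<phi> (sup_norm x)" for x
  \<comment> \<open>\<open>w r\<close> bounds the squared drop of \<open>\<phi>\<close> from radius
    \<open>r\<close> to \<open>r + 1\<close>, where the harmonic sum grows by
    \<open>1 / (r + 1)\<close>; from \<open>N\<close> on, \<open>\<phi>\<close> is zero.\<close>
  define w where "w r = (if r < N then 1 / ((real r + 1)\<^sup>2 * H\<^sup>2) else 0)" for r :: nat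
  have w0: "0 \<le> w r" for r by (simp add: w_def)
  have \<phi>0: "\<phi> r = 0" if "N \<le> r" for r
    using harm_mono[OF that, where 'a = real] H by (simp add: \<phi>_def H_def)
  have \<phi>_step: "(\<phi> r - \<phi> (Suc r))\<^sup>2 \<le> w r" for r
  proof (cases "r < N")
    case True
    \<comment> \<open>Truncation at zero does not increase differences.\<close>
    have "\<bar>\<phi> r - \<phi> (Suc r)\<bar> \<le> \<bar>(1 - harm r / H) - (1 - harm (Suc r) / H)\<bar>"
      unfolding \<phi>_def by linarith
    also have "(1 - harm r / H) - (1 - harm (Suc r) / H) = inverse (real (Suc r)) / H"
      by (simp add: harm_Suc add_divide_distrib)
    also have "\<bar>\<dots>\<bar> = 1 / ((real r + 1) * H)"
      using H by (simp add: inverse_eq_divide add.commute)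
    finally have "\<bar>\<phi> r - \<phi> (Suc r)\<bar>\<^sup>2 \<le> (1 / ((real r + 1) * H))\<^sup>2"
      by (intro power_mono) auto
    then show ?thesis using True by (simp add: w_def power_mult_distrib power_divide)
  qed (simp add: \<phi>0 w_def)
  \<comment> \<open>Across an edge the radius changes by at most one, so the bound at the smaller
    radius suffices; adding both ends makes it symmetric.\<close>
  have edge: "(f x - f y)\<^sup>2 \<le> w (sup_norm x) + w (sup_norm y)" if "open_adj \<omega> x y" for \<omega> x y
  proof -
    have "y \<in> lattice_neighbours x" "x \<in> lattice_neighbours y"
      using that by (auto simp: open_adj_def lattice_edge_iff lattice_neighbours_sym)
    then have "sup_norm y \<le> Suc (sup_norm x)" "sup_norm x \<le> Suc (sup_norm y)"
      by (simp_all add: sup_norm_neighbour)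
    then consider "sup_norm y = Suc (sup_norm x)" | "sup_norm x = Suc (sup_norm y)"
      | "sup_norm x = sup_norm y" by linarith
    then show ?thesis
    proof cases
      case 1
      then show ?thesis using \<phi>_step[of "sup_norm x"] w0[of "sup_norm y"] by (simp add: f_def)
    next
      case 2
      then show ?thesis using \<phi>_step[of "sup_norm y"] w0[of "sup_norm x"]
        by (simp add: f_def power2_commute)
    qed (simp add: f_def w0)
  qed
  have "dirichlet \<omega> B f f \<le> \<epsilon>" if B: "finite B" for \<omega> B
  proof -
    let ?a = "\<lambda>x y. of_bool (open_adj \<omega> x y) :: real"
    let ?w = "\<lambda>x. w (sup_norm x)"
    have deg: "(\<Sum>y\<in>B. ?a x y) \<le> 4" for x
    proof -
      \<comment> \<open>Neighbours of \<open>x\<close> may lie outside \<open>B\<close>; adding them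
        can only enlarge the sum, which then is the degree.\<close>
      have "(\<Sum>y\<in>B. ?a x y) \<le> (\<Sum>y\<in>B \<union> open_neighbours \<omega> x. ?a x y * 1)"
        using B unfolding mult_1_right by (intro sum_mono2) auto
      also have "\<dots> = deg \<omega> x"
        using B by (subst sum_open_adj) (auto simp: deg_def)
      finally show ?thesis using deg_le_4[of \<omega> x] by simp
    qed
    have "2 * dirichlet \<omega> B f f = (\<Sum>x\<in>B. \<Sum>y\<in>B. ?a x y * (f x - f y)\<^sup>2)"
      by (simp add: dirichlet_def power2_eq_square)
    also have "\<dots> \<le> (\<Sum>x\<in>B. \<Sum>y\<in>B. ?a x y * (?w x + ?w y))"
      using edge by (intro sum_mono) auto
    also have "\<dots> = (\<Sum>x\<in>B. \<Sum>y\<in>B. ?a x y * ?w x) + (\<Sum>x\<in>B. \<Sum>y\<in>B. ?a x y * ?w y)"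
      by (simp add: distrib_left sum.distrib)
    also have "(\<Sum>x\<in>B. \<Sum>y\<in>B. ?a x y * ?w y) = (\<Sum>x\<in>B. \<Sum>y\<in>B. ?a x y * ?w x)"
      by (subst sum.swap) (simp add: open_adj_sym)
    finally have "dirichlet \<omega> B f f \<le> (\<Sum>x\<in>B. (\<Sum>y\<in>B. ?a x y) * ?w x)"
      by (simp add: sum_distrib_right)
    also have "\<dots> \<le> (\<Sum>x\<in>B. 4 * ?w x)"
      by (intro sum_mono mult_right_mono deg w0)
    also have "\<dots> = 4 * (\<Sum>x\<in>B. ?w x)" by (simp add: sum_distrib_left)
    also have "(\<Sum>x\<in>B. ?w x) = (\<Sum>x\<in>B \<inter> {x. sup_norm x < N}. ?w x)"
      using B by (intro sum.mono_neutral_right) (auto simp: w_def)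
    also have "\<dots> \<le> (\<Sum>x | sup_norm x < N. ?w x)"
      by (intro sum_mono2) (auto intro: finite_subset[OF _ finite_square[of N]] simp: square_def w0)
    also have "\<dots> \<le> (\<Sum>r<N. 8 * (real r + 1) * w r)"
      by (rule sum_radial_le[OF w0])
    also have "\<dots> = (\<Sum>r<N. (8 / H\<^sup>2) * inverse (real (Suc r)))"
    proof (intro sum.cong refl)
      fix r assume "r \<in> {..<N}"
      moreover have "8 * t * (1 / (t\<^sup>2 * h)) = 8 / h * inverse t" if "0 < t" for t h :: real
        using that by (simp add: power2_eq_square divide_simps)
      ultimately show "8 * (real r + 1) * w r = 8 / H\<^sup>2 * inverse (real (Suc r))"
        by (simp add: w_def add.commute del: distrib_left_numeral distrib_right_numeral)
    qed
    also have "\<dots> = 8 / H\<^sup>2 * H"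
      unfolding sum_distrib_left[symmetric] H_def harm_altdef by simp
    also have "4 * (8 / H\<^sup>2 * H) = 32 / H"
      using H by (simp add: power2_eq_square)
    finally show ?thesis using H' by simp
  qed
  moreover have "f 0 = 1" by (simp add: f_def \<phi>_def sup_norm_def harm_def)
  moreover have "f x = 0" if "x \<notin> square N" for x
    using that by (simp add: f_def square_def \<phi>0)
  ultimately show ?thesis using that by blast
qed

section \<open>Range, parity and reversibility of the heat kernel\<close>

lemma heat_Suc_nonzero:
  assumes "heat \<omega> (Suc n) x y \<noteq> 0"
  obtains z where "z \<in> lattice_neighbours x" "heat \<omega> n z y \<noteq> 0"
proof -
  from assms have "(\<Sum>z\<in>open_neighbours \<omega> x. heat \<omega> n z y) \<noteq> 0" by auto
  then obtain z where "z \<in> open_neighbours \<omega> x" "heat \<omega> n z y \<noteq> 0"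
    by (rule sum.not_neutral_contains_not_neutral)
  then show ?thesis using that open_neighbours_subset by blast
qed

lemma heat_support: "heat \<omega> n x y \<noteq> 0 \<Longrightarrow> x - y \<in> square n"
proof (induction n arbitrary: x)
  case (Suc n)
  obtain z where z: "z \<in> lattice_neighbours x" "heat \<omega> n z y \<noteq> 0"
    using heat_Suc_nonzero[OF Suc.prems] .
  then have "x - y \<in> lattice_neighbours (z - y)"
    by (simp add: lattice_neighbours_def abs_minus_commute)
  with Suc.IH[OF z(2)] show ?case by (rule neighbour_in_square)
qed (auto split: if_splits simp: of_bool_def)

text \<open>The lattice is bipartite: each step flips the parity of the coordinate sum. Hence
  returns occur only at even times.\<close>

lemma heat_parity: "heat \<omega> n x y \<noteq> 0 \<Longrightarrow> even (fst x + snd x - fst y - snd y + int n)"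
proof (induction n arbitrary: x)
  case (Suc n)
  obtain z where z: "z \<in> lattice_neighbours x" "heat \<omega> n z y \<noteq> 0"
    using heat_Suc_nonzero[OF Suc.prems] .
  from z(1) have "odd (fst x + snd x - fst z - snd z)"
    unfolding lattice_neighbours_def by simp presburger
  with Suc.IH[OF z(2)] show ?case by simp presburger
qed (auto split: if_splits simp: of_bool_def)

text \<open>Clearing the denominator is valid at isolated vertices too, where both sides
  vanish.\<close>

lemma deg_mult_heat_Suc:
  "deg \<omega> x * heat \<omega> (Suc n) x y = (\<Sum>z\<in>open_neighbours \<omega> x. heat \<omega> n z y)"
  by (cases "open_neighbours \<omega> x = {}") (auto simp: deg_def)

text \<open>Reversibility with the degree as reversing weight: both sides are the same sum over
  ordered open edges. The bounds on \<open>n\<close> and \<open>m\<close> keep the neighbours of the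
  supports inside the box.\<close>

lemma heat_self_adjoint_step:
  assumes "n < L" "m < L"
  shows "(\<Sum>x\<in>square L. deg \<omega> x * heat \<omega> (Suc n) x 0 * heat \<omega> m x 0)
    = (\<Sum>x\<in>square L. deg \<omega> x * heat \<omega> n x 0 * heat \<omega> (Suc m) x 0)"
proof -
  have *: "(\<Sum>x\<in>square L. deg \<omega> x * heat \<omega> (Suc n) x 0 * heat \<omega> m x 0)
      = (\<Sum>x\<in>square L. \<Sum>y\<in>square L. of_bool (open_adj \<omega> x y) * (heat \<omega> n y 0 * heat \<omega> m x 0))"
    if "m < L" for n m
  proof (intro sum.cong refl)
    fix x
    show "deg \<omega> x * heat \<omega> (Suc n) x 0 * heat \<omega> m x 0
        = (\<Sum>y\<in>square L. of_bool (open_adj \<omega> x y) * (heat \<omega> n y 0 * heat \<omega> m x 0))"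
    proof (cases "x \<in> square m")
      case True
      then have "open_neighbours \<omega> x \<subseteq> square L"
        using open_neighbours_subset_square[OF True, of \<omega>] square_mono[of "Suc m" L] \<open>m < L\<close> by auto
      then show ?thesis
        by (simp only: sum_open_adj finite_square deg_mult_heat_Suc sum_distrib_right)
    next
      case False
      then have "heat \<omega> m x 0 = 0" using heat_support[of \<omega> m x 0] by auto
      then show ?thesis by simp
    qed
  qed
  have "(\<Sum>x\<in>square L. deg \<omega> x * heat \<omega> n x 0 * heat \<omega> (Suc m) x 0)
      = (\<Sum>x\<in>square L. \<Sum>y\<in>square L. of_bool (open_adj \<omega> x y) * (heat \<omega> m y 0 * heat \<omega> n x 0))"
    using *[OF assms(1), of m] by (simp only: mult_ac)
  also have "\<dots> = (\<Sum>x\<in>square L. \<Sum>y\<in>square L. of_bool (open_adj \<omega> x y) * (heat \<omega> n y 0 * heat \<omega> m x 0))"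
    by (subst sum.swap) (simp add: open_adj_sym mult.commute)
  finally show ?thesis using *[OF assms(2), of n] by simp
qed

text \<open>Moving steps one by one from the second factor to the first ends with
  \<open>heat \<omega> 0 x 0\<close>, which selects the origin. For \<open>n = m\<close> this turns
  a weighted sum of squares into a return probability.\<close>

lemma heat_inner_product:
  assumes "n + m < L"
  shows "(\<Sum>x\<in>square L. deg \<omega> x * heat \<omega> n x 0 * heat \<omega> m x 0) = deg \<omega> 0 * heat \<omega> (n + m) 0 0"
  using assms
proof (induction m arbitrary: n)
  case 0
  have "(\<Sum>x\<in>square L. deg \<omega> x * heat \<omega> n x 0 * heat \<omega> 0 x 0)
      = (\<Sum>x\<in>square L. if x = 0 then deg \<omega> x * heat \<omega> n x 0 else 0)"
    by (intro sum.cong) auto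
  then show ?case by simp
next
  case (Suc m)
  then show ?case
    using heat_self_adjoint_step[of n L m \<omega>] Suc.IH[of "Suc n"] by simp
qed

text \<open>If the sum were finite, the truncated Green functions \<open>g\<close> would have bounded energy, while
  \<open>dirichlet \<omega> B f g\<close> tends to \<open>deg \<omega> 0\<close> for every finitely supported \<open>f\<close> with \<open>f 0 = 1\<close>. This
  contradicts the Cauchy--Schwarz inequality as soon as \<open>f\<close> has small energy.\<close>

theorem not_summable_heat_square:
  assumes "0 < deg \<omega> 0"
  shows "\<not> summable (\<lambda>n. \<Sum>u\<in>square n. (heat \<omega> n u 0)\<^sup>2)"
proof
  define s where "s n = (\<Sum>u\<in>square n. (heat \<omega> n u 0)\<^sup>2)" for n
  assume "summable (\<lambda>n. \<Sum>u\<in>square n. (heat \<omega> n u 0)\<^sup>2)"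
  then have s: "summable s" by (simp add: s_def[abs_def])
  have s0: "0 \<le> s n" for n by (simp add: s_def sum_nonneg)
  define d where "d = deg \<omega> 0"
  have d: "0 < d" using assms by (simp add: d_def)
  have even_le: "heat \<omega> (2 * n) 0 0 \<le> 4 / d * s n" for n
  proof -
    have "d * heat \<omega> (2 * n) 0 0 = (\<Sum>x\<in>square (2 * n + 1). deg \<omega> x * heat \<omega> n x 0 * heat \<omega> n x 0)"
      using heat_inner_product[of n n "2 * n + 1" \<omega>] by (simp add: d_def mult_2)
    also have "\<dots> \<le> (\<Sum>x\<in>square (2 * n + 1). 4 * (heat \<omega> n x 0)\<^sup>2)"
      by (intro sum_mono) (simp add: power2_eq_square mult.assoc mult_right_mono deg_le_4)
    also have "\<dots> = (\<Sum>x\<in>square n. 4 * (heat \<omega> n x 0)\<^sup>2)"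
      using heat_support[of \<omega> n _ 0]
      by (intro sum.mono_neutral_right) (auto intro: square_mono[THEN subsetD, of n])
    also have "\<dots> = 4 * s n" by (simp add: s_def sum_distrib_left)
    finally show ?thesis using d by (simp add: field_simps)
  qed
  have odd_zero: "heat \<omega> (Suc (2 * n)) 0 0 = 0" for n
    using heat_parity[of \<omega> "Suc (2 * n)" 0 0] by auto
  \<comment> \<open>Bound for the Green function at the origin, truncated at any even time.\<close>
  define G where "G = 4 / d * suminf s"
  have G: "(\<Sum>n<2 * N. heat \<omega> n 0 0) \<le> G" for N
  proof -
    have "(\<Sum>n<2 * N. heat \<omega> n 0 0) \<le> 4 / d * (\<Sum>n<N. s n)"
    proof (induction N)
      case (Suc N)
      have "(\<Sum>n<2 * Suc N. heat \<omega> n 0 0)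
          = (\<Sum>n<2 * N. heat \<omega> n 0 0) + heat \<omega> (2 * N) 0 0 + heat \<omega> (Suc (2 * N)) 0 0"
        by (simp del: heat.simps)
      then show ?case using Suc.IH even_le[of N] odd_zero[of N]
        by (simp add: distrib_left del: heat.simps)
    qed simp
    also have "\<dots> \<le> G"
      unfolding G_def using d s s0 by (intro mult_left_mono sum_le_suminf) auto
    finally show ?thesis .
  qed
  \<comment> \<open>The square is at most \<open>s n\<close>, the general term of a convergent
    series.\<close>
  have lim: "(\<lambda>n. heat \<omega> n x 0) \<longlonglongrightarrow> 0" for x
  proof -
    have "(heat \<omega> n x 0)\<^sup>2 \<le> s n" for n
    proof (cases "x \<in> square n")
      case True
      then show ?thesis unfolding s_def by (intro member_le_sum) auto
    next
      case False
      then have "heat \<omega> n x 0 = 0" using heat_support[of \<omega> n x 0] by auto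
      then show ?thesis using s0[of n] by simp
    qed
    then have "(\<lambda>n. (heat \<omega> n x 0)\<^sup>2) \<longlonglongrightarrow> 0"
      by (intro tendsto_sandwich[OF _ _ tendsto_const summable_LIMSEQ_zero[OF s]]) auto
    then have "(\<lambda>n. sqrt ((heat \<omega> n x 0)\<^sup>2)) \<longlonglongrightarrow> sqrt 0"
      by (rule tendsto_real_sqrt)
    then show ?thesis by simp
  qed
  have key: "d \<le> \<epsilon> * G" if \<epsilon>: "0 < \<epsilon>" for \<epsilon>
  proof -
    obtain m f where f0: "f 0 = 1" and f_supp: "\<And>x. x \<notin> square m \<Longrightarrow> f x = 0"
      and f_energy: "\<And>\<omega> B. finite B \<Longrightarrow> dirichlet \<omega> B f f \<le> \<epsilon>"
      by (rule ex_small_energy[OF \<epsilon>]) (rule that)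
    \<comment> \<open>The error left by truncating the Green function at time \<open>N\<close>; it
      tends to 0 because \<open>f\<close> has finite support.\<close>
    define r where "r N = (\<Sum>x\<in>square m. f x * (deg \<omega> x * heat \<omega> N x 0))" for N
    have bound: "(d - r (2 * N))\<^sup>2 \<le> \<epsilon> * (d * G)" for N
    proof -
      define g where "g x = (\<Sum>n<2 * N. heat \<omega> n x 0)" for x
      define B where "B = square (Suc (max m (2 * N)))"
      have B: "finite B" "square (Suc m) \<subseteq> B" "square (Suc (2 * N)) \<subseteq> B" "0 \<in> B"
        by (simp_all add: B_def square_mono)
      have g_supp: "g x = 0" if "x \<notin> square (2 * N)" for x
        unfolding g_def
      proof (intro sum.neutral ballI)
        fix n assume "n \<in> {..<2 * N}"
        then have "x \<notin> square n" using that square_mono[of n "2 * N"] by auto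
        then show "heat \<omega> n x 0 = 0" using heat_support[of \<omega> n x 0] by auto
      qed
      have g_nonneg: "0 \<le> g x" for x by (simp add: g_def sum_nonneg)
      \<comment> \<open>By telescoping, the Laplacian of \<open>g\<close> is a point mass at the
        origin minus the kernel at time \<open>2 * N\<close>, weighted by the degree.\<close>
      have lap: "deg \<omega> x * g x - (\<Sum>y\<in>open_neighbours \<omega> x. g y)
          = deg \<omega> x * (of_bool (x = 0) - heat \<omega> (2 * N) x 0)" for x
      proof -
        have "(\<Sum>y\<in>open_neighbours \<omega> x. g y) = deg \<omega> x * (\<Sum>n<2 * N. heat \<omega> (Suc n) x 0)"
          unfolding g_def by (subst sum.swap)
            (simp only: deg_mult_heat_Suc[symmetric] sum_distrib_left)
        then have "deg \<omega> x * g x - (\<Sum>y\<in>open_neighbours \<omega> x. g y)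
            = deg \<omega> x * (\<Sum>n<2 * N. heat \<omega> n x 0 - heat \<omega> (Suc n) x 0)"
          by (simp only: g_def sum_subtractf right_diff_distrib)
        also have "(\<Sum>n<2 * N. heat \<omega> n x 0 - heat \<omega> (Suc n) x 0) = heat \<omega> 0 x 0 - heat \<omega> (2 * N) x 0"
          by (rule sum_lessThan_telescope')
        finally show ?thesis by simp
      qed
      have point: "(\<Sum>x\<in>B. k x * (deg \<omega> x * (of_bool (x = 0) - heat \<omega> (2 * N) x 0)))
          = d * k 0 - (\<Sum>x\<in>B. k x * (deg \<omega> x * heat \<omega> (2 * N) x 0))" for k
      proof -
        have "(\<Sum>x\<in>B. k x * (deg \<omega> x * of_bool (x = 0))) = (\<Sum>x\<in>B. if x = 0 then k x * deg \<omega> x else 0)"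
          by (intro sum.cong) auto
        then show ?thesis using B
          by (simp add: right_diff_distrib sum_subtractf d_def mult.commute)
      qed
      have "dirichlet \<omega> B g g
          = (\<Sum>x\<in>B. g x * (deg \<omega> x * g x - (\<Sum>y\<in>open_neighbours \<omega> x. g y)))"
        by (rule dirichlet_eq[OF g_supp B(3,1)])
      also have "\<dots> = d * g 0 - (\<Sum>x\<in>B. g x * (deg \<omega> x * heat \<omega> (2 * N) x 0))"
        unfolding lap by (rule point)
      also have "\<dots> \<le> d * g 0" by (simp add: sum_nonneg g_nonneg)
      also have "\<dots> \<le> d * G" using G[of N] d by (simp add: g_def)
      finally have gg: "dirichlet \<omega> B g g \<le> d * G" .
      have "dirichlet \<omega> B f g
          = (\<Sum>x\<in>B. f x * (deg \<omega> x * g x - (\<Sum>y\<in>open_neighbours \<omega> x. g y)))"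
        by (rule dirichlet_eq[OF f_supp B(2,1)])
      also have "\<dots> = d - (\<Sum>x\<in>B. f x * (deg \<omega> x * heat \<omega> (2 * N) x 0))"
        unfolding lap point f0 by simp
      also have "(\<Sum>x\<in>B. f x * (deg \<omega> x * heat \<omega> (2 * N) x 0)) = r (2 * N)"
        unfolding r_def using B square_mono[of m "Suc m"]
        by (intro sum.mono_neutral_right) (auto simp: f_supp)
      finally have fg: "dirichlet \<omega> B f g = d - r (2 * N)" .
      have gg0: "0 \<le> dirichlet \<omega> B g g"
        unfolding dirichlet_def by (intro divide_nonneg_nonneg sum_nonneg) auto
      have "(d - r (2 * N))\<^sup>2 \<le> dirichlet \<omega> B f f * dirichlet \<omega> B g g"
        using dirichlet_Cauchy_Schwarz[of \<omega> B f g] by (simp add: fg)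
      also have "\<dots> \<le> \<epsilon> * (d * G)"
        using f_energy[OF B(1), of \<omega>] gg gg0 \<epsilon> by (intro mult_mono) auto
      finally show ?thesis .
    qed
    have "r \<longlonglongrightarrow> (\<Sum>x\<in>square m. f x * (deg \<omega> x * 0))"
      unfolding r_def by (intro tendsto_sum tendsto_mult tendsto_const lim)
    then have "(\<lambda>N. r (2 * N)) \<longlonglongrightarrow> 0"
      by (simp add: LIMSEQ_subseq_LIMSEQ[of r _ "\<lambda>N. 2 * N", unfolded comp_def] strict_mono_def)
    then have "(\<lambda>N. (d - r (2 * N))\<^sup>2) \<longlonglongrightarrow> (d - 0)\<^sup>2"
      by (intro tendsto_intros)
    then have "d\<^sup>2 \<le> \<epsilon> * (d * G)"
      using bound by (intro LIMSEQ_le_const2[where X = "\<lambda>N. (d - r (2 * N))\<^sup>2"]) auto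
    then show ?thesis using d by (simp add: power2_eq_square)
  qed
  have "0 \<le> G" using G[of 0] by simp
  \<comment> \<open>The choice \<open>\<epsilon> = d / (2 * (G + 1))\<close> makes
    \<open>\<epsilon> * G\<close> smaller than \<open>d\<close>; the summand 1 covers
    \<open>G = 0\<close>.\<close>
  have "d \<le> d / (2 * (G + 1)) * G"
    using d \<open>0 \<le> G\<close> by (intro key) simp
  also have "\<dots> < d" using d \<open>0 \<le> G\<close> by (simp add: field_simps add_nonneg_pos)
  finally show False by simp
qed

subsection \<open>Mass transport\<close>

text \<open>Restricting to lattice edges keeps the result a point of the product space, whose
  elements are \<open>undefined\<close> off the index set.\<close>

definition translate :: "vertex \<Rightarrow> configuration \<Rightarrow> configuration" where
  "translate v \<omega> = (\<lambda>e\<in>lattice_edges. \<omega> ((+) v ` e))"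

lemma translate_lattice_edge: "e \<in> lattice_edges \<Longrightarrow> (+) v ` e \<in> lattice_edges"
proof -
  assume "e \<in> lattice_edges"
  then obtain x y where e: "e = {x, y}" "\<bar>fst x - fst y\<bar> + \<bar>snd x - snd y\<bar> = 1"
    unfolding lattice_edges_def by blast
  then have "(+) v ` e = {v + x, v + y}" "v + y \<in> lattice_neighbours (v + x)"
    by (auto simp: lattice_neighbours_def)
  then show ?thesis by (simp only: lattice_edge_iff)
qed

lemma open_adj_translate: "open_adj (translate v \<omega>) x y \<longleftrightarrow> open_adj \<omega> (v + x) (v + y)"
  by (auto simp: open_adj_def translate_def lattice_edge_iff lattice_neighbours_def)

lemma open_neighbours_translate: "open_neighbours \<omega> (v + x) = (+) v ` open_neighbours (translate v \<omega>) x"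
proof (intro set_eqI iffI)
  fix y assume "y \<in> open_neighbours \<omega> (v + x)"
  then have "y - v \<in> open_neighbours (translate v \<omega>) x" "y = v + (y - v)"
    by (auto simp: open_neighbours_def open_adj_translate)
  then show "y \<in> (+) v ` open_neighbours (translate v \<omega>) x" by blast
qed (auto simp: open_neighbours_def open_adj_translate)

lemma deg_translate: "deg (translate v \<omega>) x = deg \<omega> (v + x)"
  by (simp add: deg_def open_neighbours_translate card_image)

lemma heat_translate: "heat (translate v \<omega>) n x y = heat \<omega> n (v + x) (v + y)"
  by (induction n arbitrary: x) (simp_all add: open_neighbours_translate sum.reindex deg_translate)

lemma avoid_translate: "avoid (translate v \<omega>) n x y = avoid \<omega> n (v + x) (v + y)"
proof (induction n arbitrary: x y)
  case (Suc n)
  have "(\<Sum>x'\<in>open_neighbours \<omega> (v + x). \<Sum>y'\<in>open_neighbours \<omega> (v + y). F x' y')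
      = (\<Sum>x'\<in>open_neighbours (translate v \<omega>) x. \<Sum>y'\<in>open_neighbours (translate v \<omega>) y.
          F (v + x') (v + y'))" for F :: "vertex \<Rightarrow> vertex \<Rightarrow> real"
    by (simp add: open_neighbours_translate sum.reindex)
  then show ?case by (simp only: avoid.simps deg_translate Suc.IH add_left_cancel)
qed simp

lemma escape_translate: "escape (translate v \<omega>) x = escape \<omega> (v + x)"
  by (simp add: escape_def avoid_translate)

text \<open>A shift permutes the coordinates of a product of identical measures.\<close>

lemma distr_translate: "distr (bond_percolation p) (bond_percolation p) (translate v) = bond_percolation p"
proof -
  have "inj_on ((`) ((+) v)) lattice_edges"
    by (rule inj_on_subset[OF inj_on_image_Pow[of _ UNIV]]) auto
  moreover have "(`) ((+) v) \<in> lattice_edges \<rightarrow> lattice_edges"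
    using translate_lattice_edge by blast
  ultimately show ?thesis
    using distr_PiM_reindex[of lattice_edges "\<lambda>_. measure_pmf (bernoulli_pmf p)" "(`) ((+) v)" lattice_edges]
    by (simp add: bond_percolation_def translate_def[abs_def] measure_pmf.prob_space_axioms)
qed

section \<open>Measurability, and transport of collision mass\<close>

lemma measurable_translate [measurable]:
  "translate v \<in> measurable (bond_percolation p) (bond_percolation p)"
  unfolding bond_percolation_def translate_def[abs_def]
  by (intro measurable_restrict measurable_component_singleton translate_lattice_edge)

lemma measurable_open_adj [measurable]: "Measurable.pred (bond_percolation p) (\<lambda>\<omega>. open_adj \<omega> x y)"
proof (cases "{x, y} \<in> lattice_edges")
  case True
  then have "(\<lambda>\<omega>. \<omega> {x, y}) \<in> measurable (bond_percolation p) (measure_pmf (bernoulli_pmf p))"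
    unfolding bond_percolation_def by (rule measurable_component_singleton)
  then show ?thesis
    using True by (simp add: open_adj_def cong: measurable_cong_sets)
qed (simp add: open_adj_def)

lemma measurable_deg [measurable]: "(\<lambda>\<omega>. deg \<omega> x) \<in> borel_measurable (bond_percolation p)"
  unfolding deg_eq_sum by measurable

lemma measurable_heat [measurable]: "(\<lambda>\<omega>. heat \<omega> n x y) \<in> borel_measurable (bond_percolation p)"
proof (induction n arbitrary: x)
  case (Suc n)
  note Suc.IH [measurable]
  show ?case unfolding heat.simps sum_open_neighbours by measurable
qed simp

lemma measurable_avoid [measurable]: "(\<lambda>\<omega>. avoid \<omega> n x y) \<in> borel_measurable (bond_percolation p)"
proof (induction n arbitrary: x y)
  case (Suc n)
  note Suc.IH [measurable]
  show ?case unfolding avoid.simps sum_open_neighbours by measurable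
qed simp

lemma measurable_escape [measurable]: "(\<lambda>\<omega>. escape \<omega> x) \<in> borel_measurable (bond_percolation p)"
  unfolding escape_def by (rule borel_measurable_cINF_real) auto

text \<open>Let each vertex \<open>x\<close> send mass \<open>K\<^sup>n(x, u)\<^sup>2 q u\<close> to
  \<open>u\<close>. By translation invariance the expected mass received by the origin equals the
  expected mass it sends.\<close>

lemma collision_mass_transport:
  "(\<integral>\<^sup>+\<omega>. ennreal (escape \<omega> 0 * (\<Sum>u\<in>square n. (heat \<omega> n u 0)\<^sup>2)) \<partial>bond_percolation p)
    = (\<integral>\<^sup>+\<omega>. ennreal (\<Sum>u\<in>square n. (heat \<omega> n 0 u)\<^sup>2 * escape \<omega> u) \<partial>bond_percolation p)"
proof -
  let ?P = "bond_percolation p"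
  \<comment> \<open>Shifting by \<open>u\<close> carries the pair \<open>(- u, 0)\<close> to
    \<open>(0, u)\<close>.\<close>
  have shifted: "(\<integral>\<^sup>+\<omega>. ennreal ((heat \<omega> n (- u) 0)\<^sup>2 * escape \<omega> 0) \<partial>?P)
      = (\<integral>\<^sup>+\<omega>. ennreal ((heat \<omega> n 0 u)\<^sup>2 * escape \<omega> u) \<partial>?P)" for u
  proof -
    have "(\<integral>\<^sup>+\<omega>. ennreal ((heat \<omega> n (- u) 0)\<^sup>2 * escape \<omega> 0) \<partial>?P)
        = (\<integral>\<^sup>+\<omega>. ennreal ((heat \<omega> n (- u) 0)\<^sup>2 * escape \<omega> 0) \<partial>distr ?P ?P (translate u))"
      by (simp only: distr_translate)
    also have "\<dots> = (\<integral>\<^sup>+\<omega>. ennreal ((heat (translate u \<omega>) n (- u) 0)\<^sup>2 * escape (translate u \<omega>) 0) \<partial>?P)"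
      by (rule nn_integral_distr) measurable
    finally show ?thesis by (simp add: heat_translate escape_translate)
  qed
  have reflect: "(\<Sum>u\<in>square n. F u) = (\<Sum>u\<in>square n. F (- u))" for F :: "vertex \<Rightarrow> real"
    by (rule sum.reindex_bij_witness[where i = uminus and j = uminus]) auto
  have "(\<integral>\<^sup>+\<omega>. ennreal (escape \<omega> 0 * (\<Sum>u\<in>square n. (heat \<omega> n u 0)\<^sup>2)) \<partial>?P)
      = (\<integral>\<^sup>+\<omega>. (\<Sum>u\<in>square n. ennreal ((heat \<omega> n (- u) 0)\<^sup>2 * escape \<omega> 0)) \<partial>?P)"
    by (subst reflect) (simp add: sum_ennreal sum_distrib_left mult.commute)
  also have "\<dots> = (\<Sum>u\<in>square n. \<integral>\<^sup>+\<omega>. ennreal ((heat \<omega> n (- u) 0)\<^sup>2 * escape \<omega> 0) \<partial>?P)"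
    by (rule nn_integral_sum) measurable
  also have "\<dots> = (\<integral>\<^sup>+\<omega>. (\<Sum>u\<in>square n. ennreal ((heat \<omega> n 0 u)\<^sup>2 * escape \<omega> u)) \<partial>?P)"
    unfolding shifted by (rule nn_integral_sum[symmetric]) measurable
  finally show ?thesis by (simp add: sum_ennreal)
qed

text \<open>The last-collision bound for equal starting points, with each \<open>avoid\<close>
  replaced by its lower bound \<open>escape\<close>, which does not depend on
  \<open>N\<close>.\<close>

lemma sum_collision_escape_le:
  "(\<Sum>n<N. \<Sum>u\<in>square n. (heat \<omega> n x u)\<^sup>2 * escape \<omega> u) \<le> 1"
proof -
  have "(\<Sum>n<N. \<Sum>u\<in>square n. (heat \<omega> n x u)\<^sup>2 * escape \<omega> u)
      \<le> (\<Sum>n<N. \<Sum>u\<in>square N. heat \<omega> n x u * heat \<omega> n x u * avoid \<omega> (N - n) u u)"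
  proof (intro sum_mono)
    fix n assume "n \<in> {..<N}"
    then have "(\<Sum>u\<in>square n. (heat \<omega> n x u)\<^sup>2 * escape \<omega> u) \<le> (\<Sum>u\<in>square N. (heat \<omega> n x u)\<^sup>2 * escape \<omega> u)"
      by (intro sum_mono2 square_mono) auto
    also have "\<dots> \<le> (\<Sum>u\<in>square N. heat \<omega> n x u * heat \<omega> n x u * avoid \<omega> (N - n) u u)"
      unfolding power2_eq_square by (intro sum_mono mult_left_mono escape_le_avoid) auto
    finally show "(\<Sum>u\<in>square n. (heat \<omega> n x u)\<^sup>2 * escape \<omega> u)
        \<le> (\<Sum>u\<in>square N. heat \<omega> n x u * heat \<omega> n x u * avoid \<omega> (N - n) u u)" .
  qed
  also have "\<dots> \<le> (\<Sum>n\<le>N. \<Sum>u\<in>square N. heat \<omega> n x u * heat \<omega> n x u * avoid \<omega> (N - n) u u)"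
    by (intro sum_mono2) (auto intro!: sum_nonneg)
  also have "\<dots> \<le> 1"
    using last_collision_bound[of "square N" x x \<omega> N] by simp
  finally show ?thesis .
qed

lemma AE_escape_origin_eq_0: "AE \<omega> in bond_percolation p. 0 < deg \<omega> 0 \<longrightarrow> escape \<omega> 0 = 0"
proof -
  let ?P = "bond_percolation p"
  interpret prob_space ?P
    unfolding bond_percolation_def by (intro prob_space_PiM measure_pmf.prob_space_axioms)
  define s where "s \<omega> n = (\<Sum>u\<in>square n. (heat \<omega> n u 0)\<^sup>2)" for \<omega> n
  have s0: "0 \<le> s \<omega> n" for \<omega> n by (simp add: s_def sum_nonneg)
  have [measurable]: "(\<lambda>\<omega>. s \<omega> n) \<in> borel_measurable ?P" for n
    unfolding s_def by measurable
  have "(\<Sum>n<N. \<integral>\<^sup>+\<omega>. ennreal (escape \<omega> 0 * s \<omega> n) \<partial>?P) \<le> 1" for N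
  proof -
    have "(\<Sum>n<N. \<integral>\<^sup>+\<omega>. ennreal (escape \<omega> 0 * s \<omega> n) \<partial>?P)
        = (\<integral>\<^sup>+\<omega>. (\<Sum>n<N. ennreal (\<Sum>u\<in>square n. (heat \<omega> n 0 u)\<^sup>2 * escape \<omega> u)) \<partial>?P)"
      unfolding s_def collision_mass_transport by (rule nn_integral_sum[symmetric]) measurable
    also have "\<dots> = (\<integral>\<^sup>+\<omega>. ennreal (\<Sum>n<N. \<Sum>u\<in>square n. (heat \<omega> n 0 u)\<^sup>2 * escape \<omega> u) \<partial>?P)"
      by (simp add: sum_ennreal sum_nonneg)
    also have "\<dots> \<le> (\<integral>\<^sup>+\<omega>. 1 \<partial>?P)"
      by (rule nn_integral_mono) (simp only: ennreal_le_1 sum_collision_escape_le)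
    also have "\<dots> = 1" by (simp add: emeasure_space_1)
    finally show ?thesis .
  qed
  then have "(\<Sum>n. \<integral>\<^sup>+\<omega>. ennreal (escape \<omega> 0 * s \<omega> n) \<partial>?P) \<le> 1"
    by (intro suminf_le_const) auto
  moreover have "(\<integral>\<^sup>+\<omega>. (\<Sum>n. ennreal (escape \<omega> 0 * s \<omega> n)) \<partial>?P)
      = (\<Sum>n. \<integral>\<^sup>+\<omega>. ennreal (escape \<omega> 0 * s \<omega> n) \<partial>?P)"
    by (rule nn_integral_suminf) measurable
  ultimately have "(\<integral>\<^sup>+\<omega>. (\<Sum>n. ennreal (escape \<omega> 0 * s \<omega> n)) \<partial>?P) \<noteq> \<infinity>"
    by (auto simp: top_unique)
  \<comment> \<open>A nonnegative series of finite expectation converges almost surely.\<close>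
  then have "AE \<omega> in ?P. (\<Sum>n. ennreal (escape \<omega> 0 * s \<omega> n)) \<noteq> \<infinity>"
    by (rule nn_integral_noteq_infinite[rotated]) measurable
  then show ?thesis
  proof eventually_elim
    case (elim \<omega>)
    then have "summable (\<lambda>n. escape \<omega> 0 * s \<omega> n)"
      by (intro summable_suminf_not_top) (auto simp: s0)
    \<comment> \<open>\<open>escape \<omega> 0\<close> is constant in \<open>n\<close> and factors
      out; recurrence excludes the second alternative when the origin is not isolated.\<close>
    then have "escape \<omega> 0 = 0 \<or> summable (s \<omega>)"
      unfolding summable_cmult_iff .
    then show ?case
      using not_summable_heat_square[of \<omega>] unfolding s_def by blast
  qed
qed

text \<open>Translation carries the result at the origin to each vertex, and a countable union of
  null sets is null.\<close>

theorem AE_escape_eq_0: "AE \<omega> in bond_percolation p. \<forall>v. 0 < deg \<omega> v \<longrightarrow> escape \<omega> v = 0"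
  unfolding AE_all_countable
proof
  fix v
  have "AE \<omega> in distr (bond_percolation p) (bond_percolation p) (translate v).
      0 < deg \<omega> 0 \<longrightarrow> escape \<omega> 0 = 0"
    unfolding distr_translate by (rule AE_escape_origin_eq_0)
  then have "AE \<omega> in bond_percolation p. 0 < deg (translate v \<omega>) 0 \<longrightarrow> escape (translate v \<omega>) 0 = 0"
    by (rule AE_distrD[OF measurable_translate])
  then show "AE \<omega> in bond_percolation p. 0 < deg \<omega> v \<longrightarrow> escape \<omega> v = 0"
    by (simp add: deg_translate escape_translate)
qed

subsection \<open>Random walks given by their conditional probabilities\<close>

text \<open>Vertices are countable, so equality can be tested through the common value.\<close>

lemma measurable_collision:
  fixes X Y :: "'m \<Rightarrow> vertex"
  assumes [measurable]: "X \<in> measurable M (count_space UNIV)" "Y \<in> measurable M (count_space UNIV)"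
  shows "Measurable.pred M (\<lambda>w. X w = Y w)"
proof -
  have "(\<lambda>w. X w = Y w) = (\<lambda>w. \<exists>v. X w = v \<and> Y w = v)" by auto
  then show ?thesis by simp
qed

locale random_walk = prob_space M for M :: "'m measure" +
  fixes \<omega> :: configuration and x\<^sub>0 :: vertex and X :: "nat \<Rightarrow> 'm \<Rightarrow> vertex"
  assumes walk: "simple_random_walk M \<omega> x\<^sub>0 X"
    and start: "open_neighbours \<omega> x\<^sub>0 \<noteq> {}"
begin

lemma measurable_walk [measurable]: "X t \<in> measurable M (count_space UNIV)"
  using walk by (auto simp: simple_random_walk_def)

definition hist :: "nat \<Rightarrow> (nat \<Rightarrow> vertex) \<Rightarrow> 'm set" where
  "hist t h = {w \<in> space M. \<forall>s\<le>t. X s w = h s}"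

lemma sets_hist [measurable]: "hist t h \<in> events"
  unfolding hist_def by measurable

text \<open>The chain rule. \<open>simple_random_walk\<close> says nothing about null histories, but
  for these both sides vanish.\<close>

lemma prob_hist_Suc:
  "prob (hist (Suc t) h) = prob (hist t h) * pmf (pmf_of_set (open_neighbours \<omega> (h t))) (h (Suc t))"
proof (cases "prob (hist t h) = 0")
  case True
  have "hist (Suc t) h \<subseteq> hist t h" by (auto simp: hist_def)
  then have "prob (hist (Suc t) h) \<le> prob (hist t h)" by (intro finite_measure_mono) auto
  then show ?thesis using True measure_nonneg[of M "hist (Suc t) h"] by simp
next
  case False
  then have pos: "prob (hist t h) > 0" by (simp add: zero_less_measure_iff)
  then have "cond_prob M (\<lambda>w. X (Suc t) w = h (Suc t)) (\<lambda>w. \<forall>s\<le>t. X s w = h s)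
      = pmf (pmf_of_set (open_neighbours \<omega> (h t))) (h (Suc t))"
    using walk unfolding simple_random_walk_def hist_def by blast
  moreover have "{w \<in> space M. X (Suc t) w = h (Suc t) \<and> (\<forall>s\<le>t. X s w = h s)} = hist (Suc t) h"
    by (auto simp: hist_def le_Suc_eq)
  ultimately show ?thesis
    using pos unfolding cond_prob_def by (simp add: hist_def field_simps)
qed

text \<open>The edge just crossed can be crossed back, so a vertex reached with positive probability
  is not isolated; this keeps \<open>pmf_of_set\<close> meaningful.\<close>

lemma neighbours_nonempty: "0 < prob (hist t h) \<Longrightarrow> open_neighbours \<omega> (h t) \<noteq> {}"
proof (induction t)
  case 0
  have "AE w in M. X 0 w = x\<^sub>0" using walk by (simp add: simple_random_walk_def)
  have "h 0 = x\<^sub>0"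
  proof (rule ccontr)
    assume "h 0 \<noteq> x\<^sub>0"
    from \<open>AE w in M. X 0 w = x\<^sub>0\<close> have "AE w in M. w \<notin> hist 0 h"
      by eventually_elim (use \<open>h 0 \<noteq> x\<^sub>0\<close> in \<open>auto simp: hist_def\<close>)
    then have "prob (hist 0 h) = 0" by (simp add: prob_eq_0)
    with 0 show False by simp
  qed
  then show ?case using start by simp
next
  case (Suc t)
  then have "0 < prob (hist t h)" and p: "pmf (pmf_of_set (open_neighbours \<omega> (h t))) (h (Suc t)) \<noteq> 0"
    unfolding prob_hist_Suc by (auto simp: zero_less_mult_iff)
  then have "open_neighbours \<omega> (h t) \<noteq> {}" using Suc.IH by simp
  with p have "h (Suc t) \<in> open_neighbours \<omega> (h t)"
    by (auto simp: indicator_def split: if_splits)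
  then have "h t \<in> open_neighbours \<omega> (h (Suc t))"
    by (simp add: open_neighbours_def open_adj_sym)
  then show ?case by blast
qed

lemma prob_hist_extend:
  assumes "0 < prob (hist t h)" "x \<in> open_neighbours \<omega> (h t)"
  shows "prob (hist (Suc t) (h(Suc t := x))) = prob (hist t h) / deg \<omega> (h t)"
proof -
  have "hist t (h(Suc t := x)) = hist t h" by (auto simp: hist_def)
  moreover have "open_neighbours \<omega> (h t) \<noteq> {}" using assms(2) by blast
  ultimately show ?thesis
    using assms by (subst prob_hist_Suc) (simp add: deg_def)
qed

text \<open>Each wrong next vertex extends the history to a null one, and there are only countably
  many vertices.\<close>

lemma AE_step:
  assumes "0 < prob (hist t h)"
  shows "AE w in M. w \<in> hist t h \<longrightarrow> X (Suc t) w \<in> open_neighbours \<omega> (h t)"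
proof -
  have "AE w in M. \<forall>y. y \<notin> open_neighbours \<omega> (h t) \<longrightarrow> w \<notin> hist (Suc t) (h(Suc t := y))"
    unfolding AE_all_countable
  proof
    fix y
    show "AE w in M. y \<notin> open_neighbours \<omega> (h t) \<longrightarrow> w \<notin> hist (Suc t) (h(Suc t := y))"
    proof (cases "y \<in> open_neighbours \<omega> (h t)")
      case False
      then have "prob (hist (Suc t) (h(Suc t := y))) = 0"
        using neighbours_nonempty[OF assms] by (subst prob_hist_Suc) simp
      then show ?thesis by (simp add: prob_eq_0)
    qed simp
  qed
  then show ?thesis
  proof eventually_elim
    case (elim w)
    show ?case
    proof
      assume "w \<in> hist t h"
      then have "w \<in> hist (Suc t) (h(Suc t := X (Suc t) w))"
        by (auto simp: hist_def le_Suc_eq)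
      then show "X (Suc t) w \<in> open_neighbours \<omega> (h t)" using elim by blast
    qed
  qed
qed

end

section \<open>Collisions of two independent walks\<close>

locale two_random_walks =
  X: random_walk M \<omega> x\<^sub>0 X + Y: random_walk M \<omega> x\<^sub>0 Y
  for M :: "'m measure" and \<omega> x\<^sub>0 and X Y :: "nat \<Rightarrow> 'm \<Rightarrow> vertex" +
  assumes indep: "independent_processes M X Y"
begin

lemma measurable_meet [measurable]: "Measurable.pred M (\<lambda>w. X t w = Y t w)"
  by (intro measurable_collision X.measurable_walk Y.measurable_walk)

text \<open>Independence of the whole paths, tested on the cylinders that fix the positions up to
  time \<open>t\<close>.\<close>

lemma prob_joint_hist: "X.prob (X.hist t h \<inter> Y.hist t k) = X.prob (X.hist t h) * X.prob (Y.hist t k)"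
proof -
  let ?S = "Pi\<^sub>M UNIV (\<lambda>_ :: nat. count_space (UNIV :: vertex set))"
  have cyl: "{f. \<forall>s\<le>t. f s = h s} \<in> sets ?S" for h
  proof -
    have "{f \<in> space ?S. \<forall>s\<le>t. f s = h s} \<in> sets ?S" by measurable
    then show ?thesis by (simp add: space_PiM)
  qed
  have "X.prob ((\<lambda>w. (\<lambda>t. X t w, \<lambda>t. Y t w)) -` ({f. \<forall>s\<le>t. f s = h s} \<times> {f. \<forall>s\<le>t. f s = k s}) \<inter> space M)
    = X.prob ((\<lambda>w t. X t w) -` {f. \<forall>s\<le>t. f s = h s} \<inter> space M)
      * X.prob ((\<lambda>w t. Y t w) -` {f. \<forall>s\<le>t. f s = k s} \<inter> space M)"
    using indep unfolding independent_processes_def by (intro X.indep_varD[OF _ cyl cyl])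
  also have "(\<lambda>w t. X t w) -` {f. \<forall>s\<le>t. f s = h s} \<inter> space M = X.hist t h"
    by (auto simp: X.hist_def)
  also have "(\<lambda>w t. Y t w) -` {f. \<forall>s\<le>t. f s = k s} \<inter> space M = Y.hist t k"
    by (auto simp: Y.hist_def)
  also have "(\<lambda>w. (\<lambda>t. X t w, \<lambda>t. Y t w)) -` ({f. \<forall>s\<le>t. f s = h s} \<times> {f. \<forall>s\<le>t. f s = k s}) \<inter> space M
      = X.hist t h \<inter> Y.hist t k"
    by (auto simp: X.hist_def Y.hist_def)
  finally show ?thesis .
qed

definition avoiding :: "nat \<Rightarrow> nat \<Rightarrow> (nat \<Rightarrow> vertex) \<Rightarrow> (nat \<Rightarrow> vertex) \<Rightarrow> 'm set" where
  "avoiding n t h k =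
    {w \<in> X.hist t h \<inter> Y.hist t k. \<forall>s. t < s \<and> s \<le> t + n \<longrightarrow> X s w \<noteq> Y s w}"

lemma sets_avoiding [measurable]: "avoiding n t h k \<in> X.events"
proof -
  have "avoiding n t h k = X.hist t h \<inter> Y.hist t k \<inter>
      {w \<in> space M. \<forall>s. t < s \<and> s \<le> t + n \<longrightarrow> \<not> X s w = Y s w}"
    by (auto simp: avoiding_def X.hist_def)
  then show ?thesis by simp
qed

text \<open>Markov property of the pair, by splitting over the next two positions. The induction
  ranges over all histories because each step lengthens both. An upper bound suffices to show that
  events are null.\<close>

lemma prob_avoiding_le:
  "X.prob (avoiding n t h k) \<le> X.prob (X.hist t h) * X.prob (Y.hist t k) * avoid \<omega> n (h t) (k t)"
proof (induction n arbitrary: t h k)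
  case 0
  have "avoiding 0 t h k = X.hist t h \<inter> Y.hist t k" by (auto simp: avoiding_def)
  then show ?case by (simp add: prob_joint_hist)
next
  case (Suc n)
  let ?N = "open_neighbours \<omega>"
  let ?p = "X.prob (X.hist t h)" and ?q = "X.prob (Y.hist t k)"
  show ?case
  proof (cases "?p = 0 \<or> ?q = 0")
    case True
    have "X.prob (avoiding (Suc n) t h k) \<le> X.prob (X.hist t h \<inter> Y.hist t k)"
      by (intro X.finite_measure_mono) (auto simp: avoiding_def)
    then show ?thesis using True by (auto simp: prob_joint_hist)
  next
    case False
    then have pos: "0 < ?p" "0 < ?q" by (auto simp: zero_less_measure_iff)
    \<comment> \<open>Equal next positions give the empty event, mirroring the
      \<open>of_bool\<close> factor in \<open>avoid\<close>.\<close>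
    define E where "E x y = (if x = y then {} else avoiding n (Suc t) (h(Suc t := x)) (k(Suc t := y)))" for x y
    have sets_E [measurable]: "E x y \<in> X.events" for x y by (simp add: E_def)
    have "AE w in M. w \<in> avoiding (Suc n) t h k \<longrightarrow> w \<in> (\<Union>p\<in>?N (h t) \<times> ?N (k t). E (fst p) (snd p))"
      using X.AE_step[OF pos(1)] Y.AE_step[OF pos(2)]
    proof eventually_elim
      case (elim w)
      show ?case
      proof
        assume w: "w \<in> avoiding (Suc n) t h k"
        then have "X (Suc t) w \<in> ?N (h t)" "Y (Suc t) w \<in> ?N (k t)"
          using elim by (auto simp: avoiding_def)
        moreover have "w \<in> E (X (Suc t) w) (Y (Suc t) w)"
          using w by (auto simp: E_def avoiding_def X.hist_def Y.hist_def le_Suc_eq)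
        ultimately show "w \<in> (\<Union>p\<in>?N (h t) \<times> ?N (k t). E (fst p) (snd p))" by auto
      qed
    qed
    then have "X.prob (avoiding (Suc n) t h k) \<le> X.prob (\<Union>p\<in>?N (h t) \<times> ?N (k t). E (fst p) (snd p))"
      by (rule X.finite_measure_mono_AE) (auto intro!: sets.finite_UN)
    also have "\<dots> \<le> (\<Sum>p\<in>?N (h t) \<times> ?N (k t). X.prob (E (fst p) (snd p)))"
      by (intro X.finite_measure_subadditive_finite) auto
    also have "\<dots> = (\<Sum>x\<in>?N (h t). \<Sum>y\<in>?N (k t). X.prob (E x y))"
      by (simp add: sum.cartesian_product case_prod_unfold)
    also have "\<dots> \<le> (\<Sum>x\<in>?N (h t). \<Sum>y\<in>?N (k t).
        ?p * ?q / (deg \<omega> (h t) * deg \<omega> (k t)) * (of_bool (x \<noteq> y) * avoid \<omega> n x y))"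
    proof (intro sum_mono)
      fix x y assume "x \<in> ?N (h t)" "y \<in> ?N (k t)"
      then show "X.prob (E x y)
          \<le> ?p * ?q / (deg \<omega> (h t) * deg \<omega> (k t)) * (of_bool (x \<noteq> y) * avoid \<omega> n x y)"
        using Suc.IH[of "Suc t" "h(Suc t := x)" "k(Suc t := y)"] pos
        unfolding X.prob_hist_extend[OF pos(1) \<open>x \<in> ?N (h t)\<close>] Y.prob_hist_extend[OF pos(2) \<open>y \<in> ?N (k t)\<close>]
          fun_upd_same
        by (simp add: E_def del: fun_upd_apply)
    qed
    also have "\<dots> = ?p * ?q * avoid \<omega> (Suc n) (h t) (k t)"
      unfolding sum_distrib_left[symmetric] avoid.simps by simp
    finally show ?thesis .
  qed
qed

text \<open>Given both histories up to \<open>t\<close>, never meeting again is at most as likely as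
  avoiding for \<open>n\<close> steps, for every \<open>n\<close>. The infimum over \<open>n\<close>
  is \<open>escape\<close>, which vanishes at every vertex reached with positive
  probability.\<close>

lemma AE_not_last_collision:
  assumes escape: "\<And>v. 0 < deg \<omega> v \<Longrightarrow> escape \<omega> v = 0"
  shows "AE w in M. \<not> (X t w = Y t w \<and> (\<forall>s>t. X s w \<noteq> Y s w))"
proof -
  define F where "F h k = {w \<in> X.hist t h \<inter> Y.hist t k. X t w = Y t w \<and> (\<forall>s>t. X s w \<noteq> Y s w)}" for h k
  have F: "F h k \<in> X.events" for h k
  proof -
    have "F h k = X.hist t h \<inter> Y.hist t k \<inter>
        {w \<in> space M. X t w = Y t w \<and> (\<forall>s. t < s \<longrightarrow> \<not> X s w = Y s w)}"
      by (auto simp: F_def X.hist_def)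
    then show ?thesis by simp
  qed
  have "X.prob (F h k) = 0" for h k
  proof (cases "h t = k t")
    case False
    then have "F h k = {}" by (auto simp: F_def X.hist_def Y.hist_def)
    then show ?thesis by simp
  next
    case True
    let ?c = "X.prob (X.hist t h) * X.prob (Y.hist t k)"
    have le: "X.prob (F h k) \<le> ?c * avoid \<omega> n (h t) (h t)" for n
    proof -
      have "X.prob (F h k) \<le> X.prob (avoiding n t h k)"
        by (intro X.finite_measure_mono) (auto simp: F_def avoiding_def)
      then show ?thesis using prob_avoiding_le[of n t h k] True by simp
    qed
    show ?thesis
    proof (cases "?c = 0")
      case True
      then show ?thesis using le[of 0] measure_nonneg[of M "F h k"] unfolding True by simp
    next
      case False
      then have c: "0 < ?c" "0 < X.prob (X.hist t h)" by (auto simp: zero_less_measure_iff)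
      then have "0 < deg \<omega> (h t)"
        using X.neighbours_nonempty by (simp add: deg_def card_gt_0_iff)
      then have "escape \<omega> (h t) = 0" by (rule escape)
      moreover have "X.prob (F h k) / ?c \<le> escape \<omega> (h t)"
        unfolding escape_def using le c by (intro cINF_greatest) (auto simp: pos_divide_le_eq mult.commute)
      ultimately have "X.prob (F h k) \<le> 0" using c by (simp add: pos_divide_le_eq)
      then show ?thesis using measure_nonneg[of M "F h k"] by simp
    qed
  qed
  \<comment> \<open>There are uncountably many functions \<open>h\<close>, but only the values up to
    \<open>t\<close> matter; lists supply these and form a countable type.\<close>
  then have "AE w in M. \<forall>hs ks. w \<notin> F ((!) hs) ((!) ks)"
    unfolding AE_all_countable X.prob_eq_0[OF F, symmetric] by blast
  with AE_space show ?thesis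
  proof eventually_elim
    case (elim w)
    then have "w \<notin> F ((!) (map (\<lambda>s. X s w) [0..<Suc t])) ((!) (map (\<lambda>s. Y s w) [0..<Suc t]))"
      by blast
    then show ?case
      using elim(1) by (auto simp: F_def X.hist_def Y.hist_def less_Suc_eq_le simp del: upt_Suc)
  qed
qed

text \<open>The common start is a collision at time 0, so a finite set of collision times would have
  a maximum, which would be a last collision.\<close>

theorem AE_infinite_collisions:
  assumes "\<And>v. 0 < deg \<omega> v \<Longrightarrow> escape \<omega> v = 0"
  shows "AE w in M. infinite {t. X t w = Y t w}"
proof -
  have "AE w in M. X 0 w = x\<^sub>0" "AE w in M. Y 0 w = x\<^sub>0"
    using X.walk Y.walk by (auto simp: simple_random_walk_def)
  moreover have "AE w in M. \<forall>t. \<not> (X t w = Y t w \<and> (\<forall>s>t. X s w \<noteq> Y s w))"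
    unfolding AE_all_countable by (intro allI AE_not_last_collision assms)
  ultimately show ?thesis
  proof eventually_elim
    case (elim w)
    let ?T = "{t. X t w = Y t w}"
    show ?case
    proof
      assume fin: "finite ?T"
      have "0 \<in> ?T" using elim by simp
      then have "Max ?T \<in> ?T" using fin by (intro Max_in) auto
      moreover have "X s w \<noteq> Y s w" if "Max ?T < s" for s
        using Max_ge[OF fin, of s] that by auto
      ultimately show False using elim(3) by blast
    qed
  qed
qed

end

text \<open>An open path ending at an isolated vertex is trivial, so the cluster of such a vertex is
  a single point.\<close>

lemma infinite_cluster_neighbours_nonempty:
  assumes "infinite_cluster \<omega> C" "x \<in> C"
  shows "open_neighbours \<omega> x \<noteq> {}"
proof
  assume empty: "open_neighbours \<omega> x = {}"
  then have isolated: "\<not> open_adj \<omega> x y" "\<not> open_adj \<omega> y x" for y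
    using open_adj_sym[of \<omega> x y] unfolding open_neighbours_def by blast+
  obtain z where C: "C = open_cluster \<omega> z" "infinite C"
    using assms(1) by (auto simp: infinite_cluster_def)
  then have "(open_adj \<omega>)\<^sup>*\<^sup>* z x" using assms(2) by (simp add: open_cluster_def)
  then have "z = x" by (rule rtranclp.cases) (use isolated in blast)+
  then have "(open_adj \<omega>)\<^sup>*\<^sup>* x y" if "y \<in> C" for y
    using that C(1) by (simp add: open_cluster_def)
  then have "y = x" if "y \<in> C" for y
    using that isolated(1) converse_rtranclpE[of "open_adj \<omega>" x y] by blast
  then have "C \<subseteq> {x}" by blast
  then show False using C(2) finite_subset by blast
qed

text \<open>The exceptional null set, where \<open>escape\<close> is nonzero at some nonisolated
  vertex, depends on the configuration alone; hence clusters, starting points and pairs of walks are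
  quantified inside the almost sure statement.\<close>

theorem theorem4p1:
  fixes p :: real
  assumes "1 / 2 < p" and "p \<le> 1"
  shows "AE \<omega> in bond_percolation p.
    \<forall>C x\<^sub>0 (M :: 'm measure) X Y.
      infinite_cluster \<omega> C \<longrightarrow> x\<^sub>0 \<in> C \<longrightarrow> prob_space M \<longrightarrow>
      simple_random_walk M \<omega> x\<^sub>0 X \<longrightarrow> simple_random_walk M \<omega> x\<^sub>0 Y \<longrightarrow>
      independent_processes M X Y \<longrightarrow>
      (AE w in M. infinite {t. X t w = Y t w})"
  using AE_escape_eq_0
proof eventually_elim
  case (elim \<omega>)
  show ?case
  proof (intro allI impI)
    fix C x\<^sub>0 and M :: "'m measure" and X Y
    assume C: "infinite_cluster \<omega> C" "x\<^sub>0 \<in> C" and M: "prob_space M"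
      and walks: "simple_random_walk M \<omega> x\<^sub>0 X" "simple_random_walk M \<omega> x\<^sub>0 Y"
      and indep: "independent_processes M X Y"
    interpret two_random_walks M \<omega> x\<^sub>0 X Y
      by (intro two_random_walks.intro random_walk.intro random_walk_axioms.intro
          two_random_walks_axioms.intro M walks indep infinite_cluster_neighbours_nonempty[OF C])
    show "AE w in M. infinite {t. X t w = Y t w}"
      by (rule AE_infinite_collisions[OF elim[rule_format]])
  qed
qed

end
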